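(* Let $\mathcal{X}$ be a countable set, let $\{P_\theta\mid\theta\in\Theta\}$ be a non-empty family of probability distributions on $\mathcal{X}$, and suppose that the minimax redundancy $R_\infty=\inf_Q\sup_{\theta\in\Theta}D_\infty(P_\theta\|Q)$ (infimum over all probability distributions $Q$ on $\mathcal{X}$) is finite. Then the distribution $$S(x)=\frac{\sup_\theta P_\theta(x)}{\sum_{y\in\mathcal{X}}\sup_\theta P_\theta(y)}$$ is well defined (the normalizing sum is finite), and every probability distribution $Q$ on $\mathcal{X}$ satisfies $$\sup_\theta D_\infty(P_\theta\|Q)=R_\infty+D_\infty(S\|Q).$$ In particular, there is a unique distribution $Q_{\mathrm{opt}}$ with $\sup_\theta D_\infty(P_\theta\|Q_{\mathrm{opt}})=R_\infty$, namely $Q_{\mathrm{opt}}=S$, and $$R_\infty=\ln\sum_{x\in\mathcal{X}}\sup_\theta P_\theta(x)<\infty.$$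
   Context: For probability distributions $P,Q$ on a countable set $\mathcal{X}$, the Rényi divergence of order $\infty$ is $D_\infty(P\|Q)=\lim_{\alpha\uparrow\infty}\frac{1}{\alpha-1}\ln\sum_x P(x)^\alpha Q(x)^{1-\alpha}$, where $P(x)^\alpha Q(x)^{1-\alpha}$ is read as $P(x)^\alpha/Q(x)^{\alpha-1}$; equivalently $D_\infty(P\|Q)=\ln\sup_{x}\frac{P(x)}{Q(x)}\in[0,\infty]$, in both cases with the conventions $0/0=0$ and $y/0=\infty$ for $y>0$. *)

theory Defs
  imports "HOL-Probability.Probability"
begin

definition ln_ennreal :: "ennreal \<Rightarrow> ereal" where
  "ln_ennreal x = (if x = 0 then -\<infinity> else if x = \<infinity> then \<infinity> else ereal (ln (enn2real x)))"

definition pmfs_on :: "'a set \<Rightarrow> 'a pmf set" where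
  "pmfs_on X = {Q. set_pmf Q \<subseteq> X}"

text \<open>Division on \<^typ>\<open>ennreal\<close> satisfies \<open>0 / 0 = 0\<close> and \<open>y / 0 = \<infinity>\<close> for \<open>y > 0\<close>, and
  \<open>0 powr a = 0\<close>; these are exactly the conventions for \<open>P x powr \<alpha> / Q x powr (\<alpha> - 1)\<close>.
  Only orders \<open>\<alpha> > 1\<close> are meaningful here.\<close>

definition renyi_divergence :: "real \<Rightarrow> 'a set \<Rightarrow> 'a pmf \<Rightarrow> 'a pmf \<Rightarrow> ereal" where
  "renyi_divergence \<alpha> X P Q =
     ereal (1 / (\<alpha> - 1)) *
     ln_ennreal (\<Sum>\<^sub>\<infinity>x\<in>X. ennreal (pmf P x powr \<alpha>) / ennreal (pmf Q x powr (\<alpha> - 1)))"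

definition renyi_divergence_infty :: "'a set \<Rightarrow> 'a pmf \<Rightarrow> 'a pmf \<Rightarrow> ereal" where
  "renyi_divergence_infty X P Q = Lim at_top (\<lambda>\<alpha>. renyi_divergence \<alpha> X P Q)"

definition max_redundancy :: "'a set \<Rightarrow> 't set \<Rightarrow> ('t \<Rightarrow> 'a pmf) \<Rightarrow> 'a pmf \<Rightarrow> ereal" where
  "max_redundancy X \<Theta> P Q = (SUP \<theta>\<in>\<Theta>. renyi_divergence_infty X (P \<theta>) Q)"

definition minimax_redundancy :: "'a set \<Rightarrow> 't set \<Rightarrow> ('t \<Rightarrow> 'a pmf) \<Rightarrow> ereal" where
  "minimax_redundancy X \<Theta> P = (INF Q\<in>pmfs_on X. max_redundancy X \<Theta> P Q)"

definition sup_mass :: "'t set \<Rightarrow> ('t \<Rightarrow> 'a pmf) \<Rightarrow> 'a \<Rightarrow> ennreal" where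
  "sup_mass \<Theta> P x = (SUP \<theta>\<in>\<Theta>. ennreal (pmf (P \<theta>) x))"

end

theory Submission
  imports Defs
begin

text \<open>The divergence of order infinity is the logarithm of the largest likelihood ratio. Suprema
  of ratios commute with the supremum over the parameter, so the worst-case divergence from \<open>Q\<close>
  is \<open>ln (sup\<^sub>x s x / Q x)\<close> with \<open>s x\<close> the supremum of the masses at \<open>x\<close>. Scaling \<open>s\<close> by its
  total mass \<open>Z\<close> turns this into \<open>ln Z\<close> plus the divergence of the normalised distribution
  \<open>S = s / Z\<close> from \<open>Q\<close>, and the latter is nonnegative and vanishes only for \<open>Q = S\<close>.\<close>

section \<open>Countable sums of extended nonnegative reals, and total mass one\<close>

lemma infsum_ennreal_eq_nn_integral:
  fixes f :: "'a \<Rightarrow> ennreal"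
  assumes "countable A"
  shows "(\<Sum>\<^sub>\<infinity>x\<in>A. f x) = (\<integral>\<^sup>+x. f x \<partial>count_space A)"
proof (cases "finite A")
  case True
  then show ?thesis by (simp add: nn_integral_count_space_finite)
next
  case False
  let ?g = "from_nat_into A"
  have bij: "bij_betw ?g UNIV A"
    using bij_betw_from_nat_into[OF assms False] .
  have "(\<Sum>\<^sub>\<infinity>x\<in>A. f x) = (\<Sum>\<^sub>\<infinity>n. f (?g n))"
    by (rule infsum_reindex_bij_betw[OF bij, symmetric])
  also have "\<dots> = (\<Sum>n. f (?g n))"
    by (intro sums_unique has_sum_imp_sums has_sum_infsum nonneg_summable_on_complete) simp
  also have "\<dots> = (\<integral>\<^sup>+n. f (?g n) \<partial>count_space UNIV)"
    by (rule nn_integral_count_space_nat[symmetric])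
  also have "\<dots> = (\<integral>\<^sup>+x. f x \<partial>count_space A)"
    by (rule nn_integral_bij_count_space[OF bij])
  finally show ?thesis .
qed

lemma infsum_cmult_ennreal:
  fixes f :: "'a \<Rightarrow> ennreal"
  assumes "countable A"
  shows "(\<Sum>\<^sub>\<infinity>x\<in>A. c * f x) = c * (\<Sum>\<^sub>\<infinity>x\<in>A. f x)"
  by (simp add: infsum_ennreal_eq_nn_integral assms nn_integral_cmult)

lemma infsum_mono_ennreal:
  fixes f g :: "'a \<Rightarrow> ennreal"
  assumes "\<And>x. x \<in> A \<Longrightarrow> f x \<le> g x"
  shows "(\<Sum>\<^sub>\<infinity>x\<in>A. f x) \<le> (\<Sum>\<^sub>\<infinity>x\<in>A. g x)"
  using assms by (intro infsum_mono nonneg_summable_on_complete) auto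

lemma infsum_ge_term_ennreal:
  fixes f :: "'a \<Rightarrow> ennreal"
  assumes "x \<in> A"
  shows "f x \<le> (\<Sum>\<^sub>\<infinity>y\<in>A. f y)"
proof -
  have "(\<Sum>\<^sub>\<infinity>y\<in>{x}. f y) \<le> (\<Sum>\<^sub>\<infinity>y\<in>A. f y)"
    using assms by (intro infsum_mono_neutral nonneg_summable_on_complete) auto
  then show ?thesis by simp
qed

lemma infsum_pmf_eq_1:
  assumes "countable X" "Q \<in> pmfs_on X"
  shows "(\<Sum>\<^sub>\<infinity>x\<in>X. ennreal (pmf Q x)) = 1"
proof -
  have "set_pmf Q \<subseteq> X" using assms(2) by (simp add: pmfs_on_def)
  then have "emeasure (measure_pmf Q) X = 1"
    by (metis measure_pmf.emeasure_eq_measure measure_pmf.prob_eq_1 AE_measure_pmf_iff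
        UNIV_I sets_measure_pmf subsetD ennreal_1)
  then show ?thesis
    using assms(1) by (simp add: infsum_ennreal_eq_nn_integral nn_integral_pmf)
qed

section \<open>The logarithm with values in the extended reals\<close>

lemma ln_ennreal_ennreal: "0 < a \<Longrightarrow> ln_ennreal (ennreal a) = ereal (ln a)"
  by (simp add: ln_ennreal_def)

lemma ln_ennreal_1 [simp]: "ln_ennreal 1 = 0"
  using ln_ennreal_ennreal[of 1] by (simp add: zero_ereal_def)

text \<open>Adjunction with \<open>exp\<close>, restricted to real bounds. Suprema, monotonicity and
  every later bound on a divergence pass through it, so the values 0 and \<open>top\<close> need not
  be treated again each time.\<close>

lemma ln_ennreal_le_iff: "ln_ennreal x \<le> ereal r \<longleftrightarrow> x \<le> ennreal (exp r)"
proof (cases x)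
  case (real a)
  show ?thesis
  proof (cases "a = 0")
    case False
    then have "0 < a" using real by simp
    then show ?thesis
      using real by (simp add: ln_ennreal_ennreal) (metis exp_le_cancel_iff exp_ln)
  qed (simp add: real ln_ennreal_def)
qed (simp add: ln_ennreal_def top_unique)

text \<open>Infinity has no real upper bound and minus infinity has all of them, so the set of real
  upper bounds determines an extended real.\<close>

lemma ereal_eqI_real_upper_bounds:
  fixes a b :: ereal
  assumes "\<And>r. a \<le> ereal r \<longleftrightarrow> b \<le> ereal r"
  shows "a = b"
  by (rule antisym; rule ereal_le_real; simp add: assms)

lemma ln_ennreal_SUP: "ln_ennreal (SUP i\<in>I. f i) = (SUP i\<in>I. ln_ennreal (f i))"
  by (rule ereal_eqI_real_upper_bounds) (simp add: ln_ennreal_le_iff SUP_le_iff)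

lemma ln_ennreal_mono: "x \<le> y \<Longrightarrow> ln_ennreal x \<le> ln_ennreal y"
  by (rule ereal_le_real) (auto simp: ln_ennreal_le_iff)

lemma ln_ennreal_eq_PInfty_iff [simp]: "ln_ennreal x = \<infinity> \<longleftrightarrow> x = top"
  by (auto simp: ln_ennreal_def)

lemma ln_ennreal_mult:
  assumes "0 < a"
  shows "ln_ennreal (ennreal a * x) = ereal (ln a) + ln_ennreal x"
proof (cases x)
  case (real b)
  show ?thesis
  proof (cases "b = 0")
    case False
    then have "0 < b" using real by simp
    then show ?thesis using real assms
      by (simp add: ennreal_mult'[symmetric] ln_ennreal_ennreal ln_mult)
  qed (simp add: real ln_ennreal_def)
qed (use assms in \<open>simp add: ln_ennreal_def ennreal_mult_top\<close>)

section \<open>Likelihood ratios\<close>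

lemma ennreal_divide_le_iff:
  fixes a b c :: ennreal
  assumes "b \<noteq> top" "c \<noteq> top"
  shows "a / b \<le> c \<longleftrightarrow> a \<le> c * b"
proof (cases "b = 0")
  \<comment> \<open>\<open>a / 0\<close> is 0 or \<open>top\<close>, so both sides say
    \<open>a = 0\<close>; the left one does so because \<open>c\<close> is finite.\<close>
  case True
  then show ?thesis using assms by (auto simp: top_unique)
next
  case False
  then have "c * b / b = c"
    using assms by (metis mult_divide_eq_ennreal)
  moreover have "a / b * b = a"
    using False assms by (simp add: ennreal_divide_times less_top)
  ultimately show ?thesis
    by (metis divide_right_mono_ennreal mult_right_mono zero_le)
qed

text \<open>The numerator is an arbitrary function, so that the unnormalised \<open>sup_mass\<close>
  and a single mass function are treated alike.\<close>

definition max_ratio :: "'a set \<Rightarrow> ('a \<Rightarrow> ennreal) \<Rightarrow> 'a pmf \<Rightarrow> ennreal" where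
  "max_ratio X p Q = (SUP x\<in>X. p x / ennreal (pmf Q x))"

lemma max_ratio_le_iff:
  assumes "c \<noteq> top"
  shows "max_ratio X p Q \<le> c \<longleftrightarrow> (\<forall>x\<in>X. p x \<le> c * ennreal (pmf Q x))"
  by (simp add: max_ratio_def SUP_le_iff ennreal_divide_le_iff assms)

text \<open>Sum \<open>p x \<le> c * pmf Q x\<close> over \<open>X\<close>, with \<open>c\<close>
  the largest ratio, and use that \<open>Q\<close> has mass 1. This yields nonnegativity of the
  divergence, finiteness of the normalising sum and the lower bound on the minimax
  redundancy.\<close>

lemma infsum_le_max_ratio:
  assumes "countable X" "Q \<in> pmfs_on X"
  shows "(\<Sum>\<^sub>\<infinity>x\<in>X. p x) \<le> max_ratio X p Q"
proof (cases "max_ratio X p Q = top")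
  case False
  then have "(\<Sum>\<^sub>\<infinity>x\<in>X. p x) \<le> (\<Sum>\<^sub>\<infinity>x\<in>X. max_ratio X p Q * ennreal (pmf Q x))"
    using max_ratio_le_iff[of "max_ratio X p Q" X p Q] by (intro infsum_mono_ennreal) auto
  also have "\<dots> = max_ratio X p Q"
    using assms by (simp add: infsum_cmult_ennreal infsum_pmf_eq_1)
  finally show ?thesis .
qed simp

section \<open>Order infinity as the limit of finite orders\<close>

lemma renyi_divergence_le_iff:
  assumes "1 < \<alpha>"
  shows "renyi_divergence \<alpha> X P Q \<le> ereal r \<longleftrightarrow>
    (\<Sum>\<^sub>\<infinity>x\<in>X. ennreal (pmf P x powr \<alpha>) / ennreal (pmf Q x powr (\<alpha> - 1)))
      \<le> ennreal (exp (r * (\<alpha> - 1)))"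
proof -
  have "ereal (1 / (\<alpha> - 1)) * L \<le> ereal r \<longleftrightarrow> L \<le> ereal (r * (\<alpha> - 1))" for L
    using assms by (cases L) (auto simp: field_simps)
  then show ?thesis
    by (simp add: renyi_divergence_def ln_ennreal_le_iff)
qed

text \<open>Split one factor \<open>pmf P x\<close> off the power and bound the remaining \<alpha> -
  1 factors by \<open>exp r * pmf Q x\<close>. The powers of \<open>pmf Q x\<close> cancel, and the
  split-off factors sum to 1.\<close>

lemma renyi_divergence_le:
  assumes "countable X" "P \<in> pmfs_on X" "1 < \<alpha>"
    and "max_ratio X (\<lambda>x. ennreal (pmf P x)) Q \<le> ennreal (exp r)"
  shows "renyi_divergence \<alpha> X P Q \<le> ereal r"
proof -
  let ?c = "exp (r * (\<alpha> - 1))"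
  have "ennreal (pmf P x powr \<alpha>) / ennreal (pmf Q x powr (\<alpha> - 1)) \<le> ennreal ?c * ennreal (pmf P x)"
    if "x \<in> X" for x
  proof -
    have "ennreal (pmf P x) \<le> ennreal (exp r) * ennreal (pmf Q x)"
      using assms(4) that by (simp add: max_ratio_le_iff)
    then have le: "pmf P x \<le> exp r * pmf Q x"
      by (simp add: ennreal_mult'[symmetric])
    have "pmf P x powr \<alpha> = pmf P x powr (\<alpha> - 1) * pmf P x"
      by (cases "pmf P x = 0") (simp_all add: powr_diff)
    also have "\<dots> \<le> (exp r * pmf Q x) powr (\<alpha> - 1) * pmf P x"
      using le assms(3) by (intro mult_right_mono powr_mono2) auto
    also have "\<dots> = ?c * pmf P x * pmf Q x powr (\<alpha> - 1)"
      by (simp add: powr_mult powr_def[of "exp r"] mult_ac)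
    finally have "ennreal (pmf P x powr \<alpha>) \<le> ennreal (?c * pmf P x * pmf Q x powr (\<alpha> - 1))"
      by (rule ennreal_leI)
    then show ?thesis
      by (simp add: ennreal_divide_le_iff ennreal_mult ennreal_mult_eq_top_iff)
  qed
  then have "(\<Sum>\<^sub>\<infinity>x\<in>X. ennreal (pmf P x powr \<alpha>) / ennreal (pmf Q x powr (\<alpha> - 1)))
      \<le> (\<Sum>\<^sub>\<infinity>x\<in>X. ennreal ?c * ennreal (pmf P x))"
    by (rule infsum_mono_ennreal)
  also have "\<dots> = ennreal ?c"
    using assms by (simp add: infsum_cmult_ennreal infsum_pmf_eq_1)
  finally show ?thesis
    using assms(3) by (simp add: renyi_divergence_le_iff)
qed

text \<open>One point whose ratio exceeds \<open>exp r'\<close> suffices: its term alone is at least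
  \<open>exp (r' * (\<alpha> - 1)) * pmf P x\<close>, and the gap between \<open>r\<close> and
  \<open>r'\<close> outweighs the fixed factor \<open>pmf P x\<close> once \<alpha> is
  large.\<close>

lemma eventually_renyi_divergence_greater:
  assumes "r < r'" and "\<not> max_ratio X (\<lambda>x. ennreal (pmf P x)) Q \<le> ennreal (exp r')"
  shows "eventually (\<lambda>\<alpha>. ereal r < renyi_divergence \<alpha> X P Q) at_top"
proof -
  obtain x where "x \<in> X" and "\<not> ennreal (pmf P x) \<le> ennreal (exp r') * ennreal (pmf Q x)"
    using assms(2) by (auto simp: max_ratio_le_iff)
  then have gt: "exp r' * pmf Q x < pmf P x"
    by (simp add: ennreal_mult'[symmetric])
  moreover have "0 \<le> exp r' * pmf Q x" by simp
  ultimately have pos: "0 < pmf P x" by linarith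
  show ?thesis
    \<comment> \<open>The second bound is the solution of
      \<open>(r' - r) * (\<alpha> - 1) = - ln (pmf P x)\<close>.\<close>
    using eventually_gt_at_top[of "max 1 (1 - ln (pmf P x) / (r' - r))"]
  proof eventually_elim
    case (elim \<alpha>)
    then have \<alpha>: "1 < \<alpha>" and "- ln (pmf P x) < (r' - r) * (\<alpha> - 1)"
      using assms(1) by (auto simp: field_simps)
    then have "r * (\<alpha> - 1) < r' * (\<alpha> - 1) + ln (pmf P x)"
      by (simp add: algebra_simps)
    then have "exp (r * (\<alpha> - 1)) < exp (r' * (\<alpha> - 1)) * pmf P x"
      using pos by (metis exp_less_mono exp_add exp_ln)
    moreover have "exp (r' * (\<alpha> - 1)) * pmf P x * pmf Q x powr (\<alpha> - 1) \<le> pmf P x powr \<alpha>"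
    proof -
      have "exp (r' * (\<alpha> - 1)) * pmf P x * pmf Q x powr (\<alpha> - 1)
          = (exp r' * pmf Q x) powr (\<alpha> - 1) * pmf P x"
        by (simp add: powr_mult powr_def[of "exp r'"] mult_ac)
      also have "\<dots> \<le> pmf P x powr (\<alpha> - 1) * pmf P x"
        using gt \<alpha> by (intro mult_right_mono powr_mono2) auto
      also have "\<dots> = pmf P x powr \<alpha>"
        using pos by (simp add: powr_diff)
      finally show ?thesis .
    qed
    \<comment> \<open>If \<open>pmf Q x = 0\<close>, the left side is 0 and the right side is
      positive; otherwise the two preceding estimates chain.\<close>
    ultimately have less: "exp (r * (\<alpha> - 1)) * pmf Q x powr (\<alpha> - 1) < pmf P x powr \<alpha>"
      using pos
      by (cases "pmf Q x = 0") (auto intro: less_le_trans mult_strict_right_mono simp: less_imp_le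
          order_less_le_trans[OF mult_strict_right_mono])
    have "\<not> ennreal (pmf P x powr \<alpha>) / ennreal (pmf Q x powr (\<alpha> - 1)) \<le> ennreal (exp (r * (\<alpha> - 1)))"
      using less by (simp add: ennreal_divide_le_iff ennreal_mult'[symmetric])
    then have "\<not> (\<Sum>\<^sub>\<infinity>x\<in>X. ennreal (pmf P x powr \<alpha>) / ennreal (pmf Q x powr (\<alpha> - 1)))
        \<le> ennreal (exp (r * (\<alpha> - 1)))"
      using infsum_ge_term_ennreal[OF \<open>x \<in> X\<close>] by (meson order_trans)
    then show "ereal r < renyi_divergence \<alpha> X P Q"
      unfolding not_le[symmetric] renyi_divergence_le_iff[OF \<alpha>(1)] .
  qed
qed

lemma renyi_divergence_infty_eq:
  assumes "countable X" "P \<in> pmfs_on X"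
  shows "renyi_divergence_infty X P Q = ln_ennreal (max_ratio X (\<lambda>x. ennreal (pmf P x)) Q)"
  (is "_ = ln_ennreal ?M")
proof -
  have "((\<lambda>\<alpha>. renyi_divergence \<alpha> X P Q) \<longlongrightarrow> ln_ennreal ?M) at_top"
  proof (rule order_tendstoI)
    fix a assume "a < ln_ennreal ?M"
    then obtain r where r: "a < ereal r" "ereal r < ln_ennreal ?M" using ereal_dense2 by blast
    \<comment> \<open>A second real below the limit supplies the slack that the eventual lower bound
      consumes.\<close>
    then obtain r' where "ereal r < ereal r'" "ereal r' < ln_ennreal ?M" using ereal_dense2 by blast
    then have "eventually (\<lambda>\<alpha>. ereal r < renyi_divergence \<alpha> X P Q) at_top"
      by (intro eventually_renyi_divergence_greater[of r r'])
        (auto simp: ln_ennreal_le_iff[symmetric])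
    then show "eventually (\<lambda>\<alpha>. a < renyi_divergence \<alpha> X P Q) at_top"
      by eventually_elim (use r in auto)
  next
    fix a assume "ln_ennreal ?M < a"
    then obtain r where r: "ln_ennreal ?M < ereal r" "ereal r < a" using ereal_dense2 by blast
    then have "?M \<le> ennreal (exp r)" by (simp add: ln_ennreal_le_iff[symmetric])
    then have "renyi_divergence \<alpha> X P Q < a" if "1 < \<alpha>" for \<alpha>
      using renyi_divergence_le[OF assms that] r(2) by (meson order_le_less_trans)
    then show "eventually (\<lambda>\<alpha>. renyi_divergence \<alpha> X P Q < a) at_top"
      using eventually_gt_at_top[of 1] by (rule eventually_mono[rotated])
  qed
  then show ?thesis
    by (simp add: renyi_divergence_infty_def tendsto_Lim)
qed

section \<open>Nonnegativity of the divergence and the case of equality\<close>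

lemma max_ratio_pmf_ge_1:
  assumes "countable X" "P \<in> pmfs_on X" "Q \<in> pmfs_on X"
  shows "1 \<le> max_ratio X (\<lambda>x. ennreal (pmf P x)) Q"
  using infsum_le_max_ratio[OF assms(1,3), of "\<lambda>x. ennreal (pmf P x)"] assms
  by (simp add: infsum_pmf_eq_1)

lemma renyi_divergence_infty_nonneg:
  assumes "countable X" "P \<in> pmfs_on X" "Q \<in> pmfs_on X"
  shows "0 \<le> renyi_divergence_infty X P Q"
  using ln_ennreal_mono[OF max_ratio_pmf_ge_1[OF assms]] assms
  by (simp add: renyi_divergence_infty_eq)

lemma renyi_divergence_infty_eq_0_iff:
  assumes "countable X" "P \<in> pmfs_on X" "Q \<in> pmfs_on X"
  shows "renyi_divergence_infty X P Q = 0 \<longleftrightarrow> P = Q"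
proof -
  have "renyi_divergence_infty X P Q = 0 \<longleftrightarrow> renyi_divergence_infty X P Q \<le> ereal 0"
    using renyi_divergence_infty_nonneg[OF assms] by (auto simp: zero_ereal_def)
  also have "\<dots> \<longleftrightarrow> (\<forall>x\<in>X. pmf P x \<le> pmf Q x)"
    unfolding renyi_divergence_infty_eq[OF assms(1,2)] ln_ennreal_le_iff
    by (simp add: max_ratio_le_iff)
  \<comment> \<open>Off \<open>X\<close> the mass of \<open>P\<close> vanishes. Domination
    everywhere then forces equality, since distinct distributions exceed each other
    somewhere.\<close>
  also have "\<dots> \<longleftrightarrow> (\<forall>x. pmf P x \<le> pmf Q x)"
    using assms(2) by (auto simp: pmfs_on_def) (metis pmf_eq_0_set_pmf pmf_nonneg subsetD)
  also have "\<dots> \<longleftrightarrow> P = Q"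
    using pmf_neq_exists_less[of Q P] by (auto simp: not_le[symmetric])
  finally show ?thesis .
qed

section \<open>Worst-case redundancy of a family and normalisation of its envelope\<close>

lemma max_redundancy_eq:
  assumes "countable X" "\<And>\<theta>. \<theta> \<in> \<Theta> \<Longrightarrow> P \<theta> \<in> pmfs_on X"
  shows "max_redundancy X \<Theta> P Q = ln_ennreal (max_ratio X (sup_mass \<Theta> P) Q)"
proof -
  \<comment> \<open>Division by a fixed mass commutes with the supremum over \<theta>, and the
    suprema over \<open>x\<close> and \<theta> may be exchanged.\<close>
  have "max_ratio X (sup_mass \<Theta> P) Q
      = (SUP \<theta>\<in>\<Theta>. max_ratio X (\<lambda>x. ennreal (pmf (P \<theta>) x)) Q)"
    unfolding max_ratio_def sup_mass_def SUP_divide_ennreal by (rule SUP_commute)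
  then show ?thesis
    using assms by (simp add: max_redundancy_def ln_ennreal_SUP renyi_divergence_infty_eq)
qed

lemma exists_pmf_normalized:
  fixes p :: "'a \<Rightarrow> ennreal"
  assumes "countable X" and "\<And>x. x \<notin> X \<Longrightarrow> p x = 0"
    and sum: "(\<Sum>\<^sub>\<infinity>x\<in>X. p x) \<noteq> 0" "(\<Sum>\<^sub>\<infinity>x\<in>X. p x) \<noteq> top"
  obtains S where "S \<in> pmfs_on X" "\<And>x. ennreal (pmf S x) = p x / (\<Sum>\<^sub>\<infinity>y\<in>X. p y)"
proof -
  define Z where "Z = (\<Sum>\<^sub>\<infinity>x\<in>X. p x)"
  define S where "S = embed_pmf (\<lambda>x. enn2real (p x / Z))"
  \<comment> \<open>Each value lies below the finite total, so passing to reals for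
    \<open>embed_pmf\<close> loses nothing.\<close>
  have "p x \<noteq> top" for x
  proof (cases "x \<in> X")
    case True
    then show ?thesis using infsum_ge_term_ennreal[OF True, of p] sum(2) by (auto simp: top_unique)
  qed (simp add: assms)
  then have fin: "ennreal (enn2real (p x / Z)) = p x / Z" for x
    using sum by (simp add: Z_def ennreal_divide_eq_top_iff less_top[symmetric])
  have "(\<integral>\<^sup>+x. p x / Z \<partial>count_space UNIV) = (\<integral>\<^sup>+x. p x / Z \<partial>count_space X)"
    using assms(2) by (intro nn_integral_count_space_eq) auto
  also have "\<dots> = (\<integral>\<^sup>+x. p x \<partial>count_space X) / Z"
    by (rule nn_integral_divide) simp
  also have "\<dots> = 1"
    using sum assms(1) by (simp add: Z_def infsum_ennreal_eq_nn_integral less_top[symmetric])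
  finally have total: "(\<integral>\<^sup>+x. ennreal (enn2real (p x / Z)) \<partial>count_space UNIV) = 1"
    by (simp add: fin)
  have pmf: "pmf S x = enn2real (p x / Z)" for x
    unfolding S_def by (rule pmf_embed_pmf[OF _ total]) simp
  show thesis
  proof (rule that)
    show "S \<in> pmfs_on X"
      using assms(2) by (force simp: pmfs_on_def set_pmf_iff pmf)
    show "ennreal (pmf S x) = p x / (\<Sum>\<^sub>\<infinity>y\<in>X. p y)" for x
      by (simp add: pmf fin flip: Z_def)
  qed
qed

theorem theorem37:
  fixes X :: "'a set" and \<Theta> :: "'t set" and P :: "'t \<Rightarrow> 'a pmf"
  assumes "countable X"
    and "\<Theta> \<noteq> {}"
    and "\<And>\<theta>. \<theta> \<in> \<Theta> \<Longrightarrow> P \<theta> \<in> pmfs_on X"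
    and "\<bar>minimax_redundancy X \<Theta> P\<bar> \<noteq> \<infinity>"
  shows "(\<Sum>\<^sub>\<infinity>x\<in>X. sup_mass \<Theta> P x) < \<infinity> \<and>
    (\<exists>S\<in>pmfs_on X.
       (\<forall>x\<in>X. ennreal (pmf S x) = sup_mass \<Theta> P x / (\<Sum>\<^sub>\<infinity>y\<in>X. sup_mass \<Theta> P y)) \<and>
       (\<forall>Q\<in>pmfs_on X.
          max_redundancy X \<Theta> P Q = minimax_redundancy X \<Theta> P + renyi_divergence_infty X S Q) \<and>
       max_redundancy X \<Theta> P S = minimax_redundancy X \<Theta> P \<and>
       (\<exists>!Q. Q \<in> pmfs_on X \<and> max_redundancy X \<Theta> P Q = minimax_redundancy X \<Theta> P)) \<and>
    minimax_redundancy X \<Theta> P = ln_ennreal (\<Sum>\<^sub>\<infinity>x\<in>X. sup_mass \<Theta> P x) \<and>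
    ln_ennreal (\<Sum>\<^sub>\<infinity>x\<in>X. sup_mass \<Theta> P x) < \<infinity>"
proof -
  define s where "s = sup_mass \<Theta> P"
  define Z where "Z = (\<Sum>\<^sub>\<infinity>x\<in>X. s x)"
  have redundancy: "max_redundancy X \<Theta> P Q = ln_ennreal (max_ratio X s Q)" for Q
    unfolding s_def using assms by (intro max_redundancy_eq)
  obtain \<theta>0 where \<theta>0: "\<theta>0 \<in> \<Theta>" using assms(2) by blast
  \<comment> \<open>A single member of the family already contributes mass 1. Hence
    \<open>ln_ennreal Z\<close> is not minus infinity, and division by \<open>Z\<close> is
    harmless.\<close>
  have "1 \<le> Z"
  proof -
    have "(\<Sum>\<^sub>\<infinity>x\<in>X. ennreal (pmf (P \<theta>0) x)) \<le> Z"
      unfolding Z_def s_def sup_mass_def using \<theta>0 by (intro infsum_mono_ennreal SUP_upper)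
    then show ?thesis using assms \<theta>0 by (simp add: infsum_pmf_eq_1)
  qed
  \<comment> \<open>An infinite \<open>Z\<close> would make the redundancy of every \<open>Q\<close>
    infinite, against the finiteness of the infimum.\<close>
  have "Z \<noteq> top"
  proof
    assume "Z = top"
    then have "max_redundancy X \<Theta> P Q = \<infinity>" if "Q \<in> pmfs_on X" for Q
      using infsum_le_max_ratio[OF assms(1) that, of s] by (simp add: Z_def redundancy top_unique)
    then have "minimax_redundancy X \<Theta> P \<ge> \<infinity>"
      unfolding minimax_redundancy_def by (intro INF_greatest) simp
    with assms(4) show False by simp
  qed
  then obtain z where z: "Z = ennreal z" "0 \<le> z" by (cases Z) auto
  then have "1 \<le> z" using \<open>1 \<le> Z\<close> by (simp flip: ennreal_1)
  have lnZ: "ln_ennreal Z = ereal (ln z)" using z \<open>1 \<le> z\<close> by (simp add: ln_ennreal_ennreal)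
  have "Z \<noteq> 0" using \<open>1 \<le> Z\<close> by auto
  have "s x = 0" if "x \<notin> X" for x
  proof -
    have "pmf (P \<theta>) x = 0" if "\<theta> \<in> \<Theta>" for \<theta>
      using assms(3)[OF that] \<open>x \<notin> X\<close> by (auto simp: pmfs_on_def pmf_eq_0_set_pmf)
    then show ?thesis using assms(2) by (simp add: s_def sup_mass_def)
  qed
  then obtain S where S: "S \<in> pmfs_on X" "\<And>x. ennreal (pmf S x) = s x / Z"
    using exists_pmf_normalized[OF assms(1), of s] \<open>Z \<noteq> 0\<close> \<open>Z \<noteq> top\<close> unfolding Z_def by metis
  have "s x = Z * ennreal (pmf S x)" for x
    using \<open>Z \<noteq> 0\<close> \<open>Z \<noteq> top\<close>
    by (simp add: S(2) ennreal_times_divide mult.commute[of Z] mult_divide_eq_ennreal)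
  \<comment> \<open>The constant \<open>Z\<close> leaves the supremum; taking logarithms turns it
    into the summand \<open>ln_ennreal Z\<close>.\<close>
  then have "max_ratio X s Q = Z * max_ratio X (\<lambda>x. ennreal (pmf S x)) Q" for Q
    by (simp add: max_ratio_def SUP_mult_left_ennreal ennreal_times_divide)
  then have decomp: "max_redundancy X \<Theta> P Q = ln_ennreal Z + renyi_divergence_infty X S Q" for Q
    using z \<open>1 \<le> z\<close> lnZ assms(1) S(1)
    by (simp add: redundancy renyi_divergence_infty_eq ln_ennreal_mult)
  have SS: "max_redundancy X \<Theta> P S = ln_ennreal Z"
    using renyi_divergence_infty_eq_0_iff[OF assms(1) S(1) S(1)] by (simp add: decomp)
  have minimax: "minimax_redundancy X \<Theta> P = ln_ennreal Z"
  proof (rule antisym)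
    show "minimax_redundancy X \<Theta> P \<le> ln_ennreal Z"
      unfolding minimax_redundancy_def using S(1) SS by (metis INF_lower)
    show "ln_ennreal Z \<le> minimax_redundancy X \<Theta> P"
      unfolding minimax_redundancy_def
      by (intro INF_greatest) (simp add: redundancy Z_def assms(1) infsum_le_max_ratio ln_ennreal_mono)
  qed
  have "Q = S" if "Q \<in> pmfs_on X" "max_redundancy X \<Theta> P Q = minimax_redundancy X \<Theta> P" for Q
  proof -
    \<comment> \<open>\<open>ln_ennreal Z\<close> is the real number \<open>ln z\<close>, so it
      cancels in the extended reals.\<close>
    have "renyi_divergence_infty X S Q = 0"
      using that(2) unfolding decomp minimax lnZ
      by (cases "renyi_divergence_infty X S Q") (auto simp: zero_ereal_def)
    then show ?thesis using renyi_divergence_infty_eq_0_iff assms(1) S(1) that(1) by blast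
  qed
  then have "\<exists>!Q. Q \<in> pmfs_on X \<and> max_redundancy X \<Theta> P Q = minimax_redundancy X \<Theta> P"
    using S(1) SS minimax by auto
  then show ?thesis
    using S SS minimax decomp lnZ \<open>Z \<noteq> top\<close> unfolding Z_def s_def
    by (auto simp: less_top intro!: bexI[of _ S])
qed

end
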